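(* Let $X(0),X(1),\dots$ be i.i.d. real random variables satisfying $X_{\min}\le X(k)\le X_{\max}$, where $X_{\min}$ and $X_{\max}$ are points of the support of their common distribution with $-1\le X_{\min}<0<X_{\max}<\infty$, and assume $\mathbb{E}[X(0)]>0$. For each integer $n\ge 1$ put $\mathcal{X}_n=\prod_{k=0}^{n-1}(1+X(k))-1$, $g_n(K)=\frac{1}{n}\mathbb{E}[\log(1+K\mathcal{X}_n)]$ for $K\in[0,1]$, and $g_n^*=\max_{K\in[0,1]}g_n(K)$. If the sufficient attractiveness inequality $$\mathbb{E}\left[\frac{1}{1+X(0)}\right]\le 1$$ holds, then $g_1^*=g_n^*$ for all $n\ge 1$.
   Context: Here $\log$ is the natural logarithm with $\log 0=-\infty$, and $1/(1+X(0))$ is interpreted as $+\infty$ where $X(0)=-1$ (so the inequality forces $P(X(0)=-1)=0$). Interpretation: $g_n^*$ is the optimal per-period expected logarithmic growth for a bettor who wagers a fraction $K$ of wealth and lets the proceeds ride for $n$ periods between bet updates. *)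

theory Defs
  imports "HOL-Probability.Probability"
begin

text \<open>Topological support of a Borel measure.\<close>

definition measure_support :: "'b::topological_space measure \<Rightarrow> 'b set" where
  "measure_support \<mu> = {x. \<forall>U. open U \<longrightarrow> x \<in> U \<longrightarrow> emeasure \<mu> U > 0}"

text \<open>
  The library has \<open>ln 0 = 0\<close>; here \<open>log 0 = -\<infinity>\<close>. The value at negative arguments is a
  dummy: below, the argument is almost surely nonnegative.
\<close>

definition elog :: "real \<Rightarrow> ereal" where
  "elog x = (if x \<le> 0 then -\<infinity> else ereal (ln x))"

text \<open>
  Lebesgue integral of an extended-real function, as integral of the positive part minus integral
  of the negative part (\<open>e2ennreal\<close> sends negative numbers to \<open>0\<close>). The Bochner integral
  would return \<open>0\<close> instead of \<open>-\<infinity>\<close>. The expression is meaningful only if one of the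
  two integrals is finite; below, the positive part is almost surely bounded.
\<close>

definition ereal_expectation :: "'a measure \<Rightarrow> ('a \<Rightarrow> ereal) \<Rightarrow> ereal" where
  "ereal_expectation M Y =
     enn2ereal (\<integral>\<^sup>+\<omega>. e2ennreal (Y \<omega>) \<partial>M) - enn2ereal (\<integral>\<^sup>+\<omega>. e2ennreal (- Y \<omega>) \<partial>M)"

definition compound_return :: "(nat \<Rightarrow> 'a \<Rightarrow> real) \<Rightarrow> nat \<Rightarrow> 'a \<Rightarrow> real" where
  "compound_return X n \<omega> = (\<Prod>k<n. 1 + X k \<omega>) - 1"

definition log_growth :: "'a measure \<Rightarrow> (nat \<Rightarrow> 'a \<Rightarrow> real) \<Rightarrow> nat \<Rightarrow> real \<Rightarrow> ereal" where
  "log_growth M X n K =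
     ereal (1 / real n) * ereal_expectation M (\<lambda>\<omega>. elog (1 + K * compound_return X n \<omega>))"

text \<open>
  The maximum over \<open>K\<close> is written as a supremum; that it is attained is to be
  stated separately wherever it is used as a maximum.
\<close>

definition opt_log_growth :: "'a measure \<Rightarrow> (nat \<Rightarrow> 'a \<Rightarrow> real) \<Rightarrow> nat \<Rightarrow> ereal" where
  "opt_log_growth M X n = (SUP K\<in>{0..1}. log_growth M X n K)"

end

(* Write P for the product of the factors 1 + X(k), k < n. Since ln is below its tangent at 1,
   E ln(1 - K + K P) - E ln P = E ln((1 - K)/P + K) <= (1 - K) (E[1/P] - 1) <= 0,
   because E[1/P] is by independence the n-th power of E[1/(1 + X(0))]. Hence K = 1 is optimal for
   every n, and the growth at K = 1 is E ln(1 + X(0)) whatever n is. *)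
theory Submission
  imports Defs
begin

text \<open>Integrability makes the integrals of the positive and the negative part both finite, so
  their difference is an honest subtraction of reals. This is the bridge from \<open>elog\<close>,
  with its value \<open>-\<infinity>\<close>, to Bochner integrals of \<open>ln\<close>.\<close>

lemma ereal_expectation_eq_integral:
  assumes f: "integrable M f" and Y: "AE \<omega> in M. Y \<omega> = ereal (f \<omega>)"
  shows "ereal_expectation M Y = ereal (\<integral>\<omega>. f \<omega> \<partial>M)"
proof -
  have pos: "(\<integral>\<^sup>+\<omega>. e2ennreal (Y \<omega>) \<partial>M) = (\<integral>\<^sup>+\<omega>. ennreal (f \<omega>) \<partial>M)"
    by (rule nn_integral_cong_AE) (use Y in \<open>auto simp: ennreal.rep_eq ennreal_def\<close>)
  have neg: "(\<integral>\<^sup>+\<omega>. e2ennreal (- Y \<omega>) \<partial>M) = (\<integral>\<^sup>+\<omega>. ennreal (- f \<omega>) \<partial>M)"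
    by (rule nn_integral_cong_AE) (use Y in \<open>auto simp: ennreal.rep_eq ennreal_def\<close>)
  obtain r q where r: "0 \<le> r" "(\<integral>\<^sup>+\<omega>. ennreal (f \<omega>) \<partial>M) = ennreal r"
    and q: "0 \<le> q" "(\<integral>\<^sup>+\<omega>. ennreal (- f \<omega>) \<partial>M) = ennreal q"
    and "(\<integral>\<omega>. f \<omega> \<partial>M) = r - q"
    using integrableE[OF f] by metis
  then show ?thesis
    unfolding ereal_expectation_def pos neg by simp
qed

text \<open>The tangent bound at \<open>x\<close> controls \<open>ln x\<close> from above, and at
  \<open>1 / x\<close> from below. The right-hand side serves as an integrable majorant for
  \<open>ln (1 + X k)\<close>.\<close>

lemma abs_ln_le_add_inverse:
  fixes x :: real
  assumes "0 < x"
  shows "\<bar>ln x\<bar> \<le> x + 1 / x"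
proof -
  have "ln x \<le> x - 1" "ln (1 / x) \<le> 1 / x - 1"
    using assms by (simp_all add: ln_le_minus_one)
  moreover have "ln (1 / x) = - ln x" "0 < 1 / x"
    using assms by (simp_all add: ln_div)
  ultimately show ?thesis using assms by linarith
qed

text \<open>A convex combination of 1 and \<open>x\<close> lies between them, and \<open>ln\<close>
  is increasing with \<open>ln 1 = 0\<close>. So moving towards 1 can only shrink the absolute value
  of \<open>ln\<close>, which gives one majorant for all \<open>K\<close>.\<close>

lemma abs_ln_convex_combination_le:
  fixes x K :: real
  assumes "0 < x" "0 \<le> K" "K \<le> 1"
  shows "0 < 1 - K + K * x" "\<bar>ln (1 - K + K * x)\<bar> \<le> \<bar>ln x\<bar>"
proof -
  have "1 - K + K * x \<ge> min 1 x \<and> 1 - K + K * x \<le> max 1 x"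
  proof (cases "x \<le> 1")
    case True
    have "K * x \<le> K" "(1 - K) * x \<le> 1 - K"
      using True assms by (simp_all add: mult_left_le)
    then show ?thesis using True by (simp add: algebra_simps)
  next
    case False
    have "K * 1 \<le> K * x" "(1 - K) * 1 \<le> (1 - K) * x"
      using False assms by (intro mult_left_mono; simp)+
    then show ?thesis using False by (simp add: algebra_simps)
  qed
  then have bounds: "min 1 x \<le> 1 - K + K * x" "1 - K + K * x \<le> max 1 x" by auto
  show pos: "0 < 1 - K + K * x" using bounds(1) assms(1) by linarith
  have "ln (min 1 x) \<le> ln (1 - K + K * x)" "ln (1 - K + K * x) \<le> ln (max 1 x)"
    using bounds pos assms(1) by (subst ln_le_cancel_iff; simp)+
  then show "\<bar>ln (1 - K + K * x)\<bar> \<le> \<bar>ln x\<bar>"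
    by (auto simp: min_def max_def split: if_splits)
qed

text \<open>The tangent bound is applied to the ratio of the two arguments,
  \<open>(1 - K) / x + K\<close>, whose excess over 1 is exactly the correction term.\<close>

lemma ln_convex_combination_le:
  fixes x K :: real
  assumes "0 < x" "0 \<le> K" "K \<le> 1"
  shows "ln (1 - K + K * x) \<le> ln x + (1 - K) * (1 / x - 1)"
proof -
  have pos: "0 < 1 - K + K * x" using abs_ln_convex_combination_le(1)[OF assms] .
  have "ln (1 - K + K * x) - ln x = ln ((1 - K + K * x) / x)"
    using pos assms(1) by (simp add: ln_div)
  also have "\<dots> \<le> (1 - K + K * x) / x - 1"
    using pos assms(1) by (intro ln_le_minus_one) simp
  also have "\<dots> = (1 - K) * (1 / x - 1)"
    using assms(1) by (simp add: field_simps)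
  finally show ?thesis by simp
qed

text \<open>Integrating the pointwise bound leaves a correction of expectation at most 0. Here
  \<open>P\<close> stands for the gross return over \<open>n\<close> periods, so betting everything,
  \<open>K = 1\<close>, is at least as good as any other \<open>K\<close>.\<close>

lemma (in prob_space) expectation_ln_convex_combination:
  fixes P :: "'a \<Rightarrow> real" and K :: real
  assumes P[measurable]: "P \<in> borel_measurable M"
    and pos: "AE \<omega> in M. 0 < P \<omega>"
    and ln: "integrable M (\<lambda>\<omega>. ln (P \<omega>))"
    and inv: "integrable M (\<lambda>\<omega>. 1 / P \<omega>)" "expectation (\<lambda>\<omega>. 1 / P \<omega>) \<le> 1"
    and K: "0 \<le> K" "K \<le> 1"
  shows "integrable M (\<lambda>\<omega>. ln (1 - K + K * P \<omega>))"
    and "expectation (\<lambda>\<omega>. ln (1 - K + K * P \<omega>)) \<le> expectation (\<lambda>\<omega>. ln (P \<omega>))"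
proof -
  show int: "integrable M (\<lambda>\<omega>. ln (1 - K + K * P \<omega>))"
  proof (rule Bochner_Integration.integrable_bound[OF ln])
    show "AE \<omega> in M. norm (ln (1 - K + K * P \<omega>)) \<le> norm (ln (P \<omega>))"
      using pos by eventually_elim (simp add: abs_ln_convex_combination_le K)
  qed measurable
  have rhs: "integrable M (\<lambda>\<omega>. ln (P \<omega>) + (1 - K) * (1 / P \<omega> - 1))"
    using ln inv(1) by simp
  have "expectation (\<lambda>\<omega>. ln (1 - K + K * P \<omega>))
      \<le> expectation (\<lambda>\<omega>. ln (P \<omega>) + (1 - K) * (1 / P \<omega> - 1))"
    by (rule integral_mono_AE[OF int rhs])
      (use pos in eventually_elim, simp add: ln_convex_combination_le K)
  also have "\<dots> = expectation (\<lambda>\<omega>. ln (P \<omega>)) + (1 - K) * (expectation (\<lambda>\<omega>. 1 / P \<omega>) - 1)"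
    using ln inv(1) by (simp add: prob_space)
  also have "\<dots> \<le> expectation (\<lambda>\<omega>. ln (P \<omega>))"
    using inv(2) K by (simp add: mult_nonneg_nonpos)
  finally show "expectation (\<lambda>\<omega>. ln (1 - K + K * P \<omega>)) \<le> expectation (\<lambda>\<omega>. ln (P \<omega>))" .
qed

text \<open>Both sides depend on the law alone, by change of variables. It carries facts about
  \<open>X 0\<close> over to every \<open>X k\<close>, with \<open>h\<close> being
  \<open>1 / (1 + x)\<close> or \<open>ln (1 + x)\<close>.\<close>

lemma identically_distributed:
  fixes U V :: "'a \<Rightarrow> real" and h :: "real \<Rightarrow> real"
  assumes "distr M borel U = distr M borel V"
    and [measurable]: "U \<in> borel_measurable M" "V \<in> borel_measurable M" "h \<in> borel_measurable borel"
  shows "integrable M (\<lambda>\<omega>. h (U \<omega>)) \<longleftrightarrow> integrable M (\<lambda>\<omega>. h (V \<omega>))"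
    and "(\<integral>\<omega>. h (U \<omega>) \<partial>M) = (\<integral>\<omega>. h (V \<omega>) \<partial>M)"
proof -
  have "integrable (distr M borel U) h = integrable M (\<lambda>\<omega>. h (U \<omega>))"
    "integrable (distr M borel V) h = integrable M (\<lambda>\<omega>. h (V \<omega>))"
    by (simp_all add: integrable_distr_eq)
  then show "integrable M (\<lambda>\<omega>. h (U \<omega>)) \<longleftrightarrow> integrable M (\<lambda>\<omega>. h (V \<omega>))"
    using assms(1) by simp
  have "integral\<^sup>L (distr M borel U) h = (\<integral>\<omega>. h (U \<omega>) \<partial>M)"
    "integral\<^sup>L (distr M borel V) h = (\<integral>\<omega>. h (V \<omega>) \<partial>M)"
    by (simp_all add: integral_distr)
  then show "(\<integral>\<omega>. h (U \<omega>) \<partial>M) = (\<integral>\<omega>. h (V \<omega>) \<partial>M)"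
    using assms(1) by simp
qed

text \<open>A finite integral forces a finite integrand almost everywhere. In
  \<open>ennreal\<close>, \<open>1 / 0\<close> is infinite and negative reals are sent to 0, so
  \<open>Y\<close> must be positive; there the real quotient agrees with the extended one.\<close>

lemma nn_integral_inverse_le_1:
  fixes Y :: "'a \<Rightarrow> real"
  assumes [measurable]: "Y \<in> borel_measurable M"
    and le: "(\<integral>\<^sup>+\<omega>. 1 / ennreal (Y \<omega>) \<partial>M) \<le> 1"
  shows "AE \<omega> in M. 0 < Y \<omega>"
    and "integrable M (\<lambda>\<omega>. 1 / Y \<omega>)"
    and "(\<integral>\<omega>. 1 / Y \<omega> \<partial>M) \<le> 1"
proof -
  have "AE \<omega> in M. 1 / ennreal (Y \<omega>) \<noteq> \<infinity>"
    using le by (intro nn_integral_noteq_infinite) (auto simp: top_unique)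
  then show pos: "AE \<omega> in M. 0 < Y \<omega>"
    by eventually_elim (metis divide_ennreal_def ennreal_inverse_zero ennreal_neg infinity_ennreal_def linorder_not_less mult_1)
  have eq: "(\<integral>\<^sup>+\<omega>. ennreal (1 / Y \<omega>) \<partial>M) = (\<integral>\<^sup>+\<omega>. 1 / ennreal (Y \<omega>) \<partial>M)"
    by (rule nn_integral_cong_AE)
      (use pos in \<open>eventually_elim, simp add: divide_ennreal[symmetric] del: divide_ennreal\<close>)
  have nonneg: "AE \<omega> in M. 0 \<le> 1 / Y \<omega>"
    using pos by eventually_elim simp
  show int: "integrable M (\<lambda>\<omega>. 1 / Y \<omega>)"
    using le eq nonneg by (intro integrableI_nonneg) (auto intro: le_less_trans)
  show "(\<integral>\<omega>. 1 / Y \<omega> \<partial>M) \<le> 1"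
    using le nn_integral_eq_integral[OF int nonneg] unfolding eq by (simp add: ennreal_le_1)
qed

theorem mainTheorem3:
  fixes M :: "'a measure" and X :: "nat \<Rightarrow> 'a \<Rightarrow> real" and Xmin Xmax :: real
  assumes "prob_space M"
    and "prob_space.indep_vars M (\<lambda>_. borel) X UNIV"
    and "\<And>k. distr M borel (X k) = distr M borel (X 0)"
    and "\<And>k. AE \<omega> in M. Xmin \<le> X k \<omega> \<and> X k \<omega> \<le> Xmax"
    and "Xmin \<in> measure_support (distr M borel (X 0))"
    and "Xmax \<in> measure_support (distr M borel (X 0))"
    and "-1 \<le> Xmin" and "Xmin < 0" and "0 < Xmax"
    and "prob_space.expectation M (X 0) > 0"
    and "(\<integral>\<^sup>+\<omega>. 1 / ennreal (1 + X 0 \<omega>) \<partial>M) \<le> 1"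
  shows "\<forall>n\<ge>1. (\<exists>K\<in>{0..1}. log_growth M X n K = opt_log_growth M X n) \<and>
           opt_log_growth M X 1 = opt_log_growth M X n"
proof -
  interpret prob_space M by fact
  have X[measurable]: "X k \<in> borel_measurable M" for k
    using assms(2) by (simp add: indep_vars_def2)
  \<comment> \<open>The attractiveness inequality enters here: it rules out total loss and bounds
    the real expectation of the inverse.\<close>
  note inv0 = nn_integral_inverse_le_1[of "\<lambda>\<omega>. 1 + X 0 \<omega>" M, OF _ assms(11), simplified]
  have inv_int: "integrable M (\<lambda>\<omega>. 1 / (1 + X k \<omega>))" for k
    using identically_distributed(1)[OF assms(3) X X, of "\<lambda>x. 1 / (1 + x)" k] inv0(2) by simp
  have inv_le: "expectation (\<lambda>\<omega>. 1 / (1 + X k \<omega>)) \<le> 1" for k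
    using identically_distributed(2)[OF assms(3) X X, of "\<lambda>x. 1 / (1 + x)" k] inv0(3) by simp
  have pos: "AE \<omega> in M. 0 < 1 + X k \<omega>" for k
  proof -
    \<comment> \<open>Only the laws of \<open>X 0\<close> and \<open>X k\<close> coincide, so
      positivity is moved to the law and back.\<close>
    have "AE x in distr M borel (X 0). 0 < 1 + x"
      by (subst AE_distr_iff) (use inv0(1) in auto)
    then have "AE x in distr M borel (X k). 0 < 1 + x"
      by (subst assms(3))
    then show ?thesis
      by (subst (asm) AE_distr_iff) auto
  qed
  have X_int: "integrable M (X k)" for k
  proof (rule integrable_const_bound)
    show "AE \<omega> in M. norm (X k \<omega>) \<le> max \<bar>Xmin\<bar> \<bar>Xmax\<bar>"
      using assms(4)[of k] by (rule eventually_mono) auto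
  qed measurable
  have ln_int: "integrable M (\<lambda>\<omega>. ln (1 + X k \<omega>))" for k
  proof (rule Bochner_Integration.integrable_bound)
    \<comment> \<open>\<open>X k\<close> is bounded, which handles large gains; the inverse moment
      handles returns close to -1.\<close>
    show "integrable M (\<lambda>\<omega>. 1 + X k \<omega> + 1 / (1 + X k \<omega>))"
      using X_int inv_int by simp
    show "AE \<omega> in M. norm (ln (1 + X k \<omega>)) \<le> norm (1 + X k \<omega> + 1 / (1 + X k \<omega>))"
      using pos[of k]
    proof eventually_elim
      case (elim \<omega>)
      show ?case using abs_ln_le_add_inverse[OF elim] by simp
    qed
  qed measurable
  \<comment> \<open>The candidate for the common optimum: the one-period growth at
    \<open>K = 1\<close>.\<close>
  define c where "c = expectation (\<lambda>\<omega>. ln (1 + X 0 \<omega>))"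
  have ln_c: "expectation (\<lambda>\<omega>. ln (1 + X k \<omega>)) = c" for k
    unfolding c_def
    using identically_distributed(2)[OF assms(3) X X, of "\<lambda>x. ln (1 + x)" k] by simp
  have main: "log_growth M X n 1 = ereal c \<and> opt_log_growth M X n = ereal c" if n: "n \<ge> 1" for n
  proof -
    define P where "P \<omega> = (\<Prod>k<n. 1 + X k \<omega>)" for \<omega>
    have P[measurable]: "P \<in> borel_measurable M" unfolding P_def by measurable
    have pos_all: "AE \<omega> in M. \<forall>k<n. 0 < 1 + X k \<omega>"
      using pos by (simp add: AE_all_countable)
    have P_pos: "AE \<omega> in M. 0 < P \<omega>"
      using pos_all by eventually_elim (auto simp: P_def intro!: prod_pos)
    \<comment> \<open>The logarithm of the product splits because all \<open>n\<close> factors are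
      positive outside a single null set.\<close>
    have ln_P: "AE \<omega> in M. (\<Sum>k<n. ln (1 + X k \<omega>)) = ln (P \<omega>)"
      using pos_all
    proof eventually_elim
      case (elim \<omega>)
      show ?case unfolding P_def using elim by (subst ln_prod) (auto simp: less_imp_neq[symmetric])
    qed
    have sum_int: "integrable M (\<lambda>\<omega>. \<Sum>k<n. ln (1 + X k \<omega>))"
      using ln_int by simp
    have lnP_int: "integrable M (\<lambda>\<omega>. ln (P \<omega>))"
      using sum_int by (rule integrable_cong_AE_imp) (use ln_P in \<open>auto elim!: eventually_mono\<close>)
    have lnP_exp: "expectation (\<lambda>\<omega>. ln (P \<omega>)) = real n * c"
    proof -
      have "expectation (\<lambda>\<omega>. ln (P \<omega>)) = expectation (\<lambda>\<omega>. \<Sum>k<n. ln (1 + X k \<omega>))"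
        by (rule integral_cong_AE) (use ln_P in \<open>auto elim!: eventually_mono\<close>)
      also have "\<dots> = (\<Sum>k<n. c)"
        using ln_int by (simp add: ln_c)
      finally show ?thesis by simp
    qed
    have indep: "indep_vars (\<lambda>_. borel) (\<lambda>k \<omega>. 1 / (1 + X k \<omega>)) {..<n}"
      by (rule indep_vars_compose2[OF indep_vars_subset[OF assms(2)], of _ "\<lambda>_ x. 1 / (1 + x)"]) auto
    have invP: "1 / P \<omega> = (\<Prod>k<n. 1 / (1 + X k \<omega>))" for \<omega>
      by (simp add: P_def prod_dividef)
    have invP_int: "integrable M (\<lambda>\<omega>. 1 / P \<omega>)"
      unfolding invP using n by (intro indep_vars_integrable[OF _ indep inv_int]) auto
    have "expectation (\<lambda>\<omega>. 1 / P \<omega>) = (\<Prod>k<n. expectation (\<lambda>\<omega>. 1 / (1 + X k \<omega>)))"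
      unfolding invP using n by (intro indep_vars_lebesgue_integral[OF _ indep inv_int]) auto
    \<comment> \<open>Each factor lies between 0 and 1; the lower bound comes from almost sure
      positivity of \<open>1 + X k\<close>.\<close>
    also have "\<dots> \<le> 1"
    proof (rule prod_le_1)
      fix k
      have "0 \<le> expectation (\<lambda>\<omega>. 1 / (1 + X k \<omega>))"
        by (rule integral_nonneg_AE) (use pos[of k] in \<open>auto elim!: eventually_mono\<close>)
      then show "0 \<le> expectation (\<lambda>\<omega>. 1 / (1 + X k \<omega>)) \<and> expectation (\<lambda>\<omega>. 1 / (1 + X k \<omega>)) \<le> 1"
        using inv_le by simp
    qed
    finally have invP_le: "expectation (\<lambda>\<omega>. 1 / P \<omega>) \<le> 1" .
    have growth: "log_growth M X n K = ereal (expectation (\<lambda>\<omega>. ln (1 - K + K * P \<omega>)) / real n)"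
      if K: "0 \<le> K" "K \<le> 1" for K
    proof -
      have "AE \<omega> in M. elog (1 + K * compound_return X n \<omega>) = ereal (ln (1 - K + K * P \<omega>))"
        using P_pos
      proof eventually_elim
        case (elim \<omega>)
        \<comment> \<open>As a convex combination of 1 and a positive number the argument is
          positive, so \<open>elog\<close> takes its finite branch.\<close>
        have "1 + K * compound_return X n \<omega> = 1 - K + K * P \<omega>"
          by (simp add: compound_return_def P_def algebra_simps)
        then show ?case
          using abs_ln_convex_combination_le(1)[OF elim K] by (simp add: elog_def)
      qed
      from ereal_expectation_eq_integral[OF _ this]
      show ?thesis
        using expectation_ln_convex_combination(1)[OF P P_pos lnP_int invP_int invP_le K]
        by (simp add: log_growth_def)
    qed
    \<comment> \<open>At \<open>K = 1\<close> the expectation is \<open>n * c\<close>, and the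
      factor \<open>1 / n\<close> cancels \<open>n\<close>, which is nonzero.\<close>
    have one: "log_growth M X n 1 = ereal c"
      using growth[of 1] n by (simp add: lnP_exp)
    have le: "log_growth M X n K \<le> ereal c" if "K \<in> {0..1}" for K
    proof -
      have K: "0 \<le> K" "K \<le> 1" using that by auto
      show ?thesis
        using expectation_ln_convex_combination(2)[OF P P_pos lnP_int invP_int invP_le K] n
        by (simp add: growth[OF K] lnP_exp field_simps)
    qed
    have "opt_log_growth M X n = ereal c"
      unfolding opt_log_growth_def
    proof (rule antisym)
      show "(SUP K\<in>{0..1}. log_growth M X n K) \<le> ereal c"
        by (rule SUP_least) (rule le)
      show "ereal c \<le> (SUP K\<in>{0..1}. log_growth M X n K)"
        \<comment> \<open>The witness \<open>K = 1\<close> attains the bound, so the supremum is a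
          maximum.\<close>
        by (rule SUP_upper2[of 1]) (simp_all add: one)
    qed
    with one show ?thesis by simp
  qed
  show ?thesis
  proof (intro allI impI conjI)
    fix n :: nat assume n: "n \<ge> 1"
    show "\<exists>K\<in>{0..1}. log_growth M X n K = opt_log_growth M X n"
      using main[OF n] by (intro bexI[of _ 1]) auto
    show "opt_log_growth M X 1 = opt_log_growth M X n"
      using main[OF n] main[of 1] by simp
  qed
qed

end
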